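(* Let $\Omega$ be an h-convex domain in $\mathbb{H}$ and suppose that $f:\Omega\to\mathbb{R}$ is bounded from below. Let $T$ be the operator given by $$T[f](w)=\inf\left\{\max\{f(p),f(q)\}:\ w\in[p,q],\ p\in\Omega,\ q\in\Omega\cap\mathbb{H}_p\right\},\quad w\in\Omega,$$ and let $T^n$ denote its $n$-fold iterate. Then $T^n[f]\to Q(f)$ pointwise in $\Omega$ as $n\to\infty$, where $Q(f)$ is the h-quasiconvex envelope of $f$ in $\Omega$.
   Context: The Heisenberg group $\mathbb{H}$ is $\mathbb{R}^3$ (with its usual topology) with the group law $(x_p,y_p,z_p)\cdot(x_q,y_q,z_q)=(x_p+x_q,\,y_p+y_q,\,z_p+z_q+\frac12(x_py_q-x_qy_p))$. Let $\mathbb{H}_0=\{(x,y,0):x,y\in\mathbb{R}\}$ and, for $p\in\mathbb{H}$, $\mathbb{H}_p=\{p\cdot h:h\in\mathbb{H}_0\}$. For $q\in\mathbb{H}_p$, $[p,q]$ denotes the horizontal segment joining $p$ and $q$ (the straight segment from $p$ to $q$). A domain is a connected open set. A set $E\subset\mathbb{H}$ is h-convex if $[p,q]\subset E$ for every $p\in E$ and $q\in\mathbb{H}_p\cap E$. For $\Omega$ h-convex, $u:\Omega\to\mathbb{R}$ is h-quasiconvex if $u(w)\le\max\{u(p),u(q)\}$ for all $p\in\Omega$, $q\in\mathbb{H}_p\cap\Omega$, $w\in[p,q]$. The h-quasiconvex envelope of $f$ in $\Omega$ is $Q(f)(p)=\sup\{g(p): g\le f\text{ in }\Omega,\ g:\Omega\to\mathbb{R}\text{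 h-quasiconvex}\}$, with $\sup\emptyset=-\infty$. *)

theory Defs
  imports "HOL-Analysis.Analysis"
begin

type_synonym heis = "real \<times> real \<times> real"

fun heis_mult :: "heis \<Rightarrow> heis \<Rightarrow> heis"  (infixl "\<cdot>\<^sub>H" 70) where
  "(x1, y1, z1) \<cdot>\<^sub>H (x2, y2, z2) = (x1 + x2, y1 + y2, z1 + z2 + (x1 * y2 - x2 * y1) / 2)"

definition horizontal_plane0 :: "heis set" where
  "horizontal_plane0 = {(x, y, 0) |x y. True}"

definition horizontal_plane :: "heis \<Rightarrow> heis set" where
  "horizontal_plane p = {p \<cdot>\<^sub>H h |h. h \<in> horizontal_plane0}"

definition h_convex :: "heis set \<Rightarrow> bool" where
  "h_convex E \<longleftrightarrow> (\<forall>p\<in>E. \<forall>q\<in>horizontal_plane p \<inter> E. closed_segment p q \<subseteq> E)"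

text \<open>Functions on \<open>\<Omega>\<close> are total functions of which only the values on \<open>\<Omega>\<close> are used.\<close>

definition h_quasiconvex_on :: "heis set \<Rightarrow> (heis \<Rightarrow> real) \<Rightarrow> bool" where
  "h_quasiconvex_on \<Omega> u \<longleftrightarrow>
     (\<forall>p\<in>\<Omega>. \<forall>q\<in>horizontal_plane p \<inter> \<Omega>. \<forall>w\<in>closed_segment p q. u w \<le> max (u p) (u q))"

text \<open>The envelope is extended-real-valued, so that an empty supremum is \<open>-\<infinity>\<close>.\<close>

definition h_quasiconvex_envelope :: "heis set \<Rightarrow> (heis \<Rightarrow> real) \<Rightarrow> heis \<Rightarrow> ereal" where
  "h_quasiconvex_envelope \<Omega> f p =
     Sup {ereal (g p) |g. h_quasiconvex_on \<Omega> g \<and> (\<forall>x\<in>\<Omega>. g x \<le> f x)}"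

text \<open>The operator \<open>T\<close>. It acts on extended-real-valued functions so that the infimum
  is the true one without any boundedness assumption and \<open>T\<close> can be iterated.\<close>

definition h_conv_operator :: "heis set \<Rightarrow> (heis \<Rightarrow> ereal) \<Rightarrow> heis \<Rightarrow> ereal" where
  "h_conv_operator \<Omega> f w =
     Inf {max (f p) (f q) |p q.
            w \<in> closed_segment p q \<and> p \<in> \<Omega> \<and> q \<in> \<Omega> \<inter> horizontal_plane p}"

end

theory Submission
  imports Defs
begin

text \<open>The iterates \<open>T\<^sup>n[f]\<close> decrease, and each of them dominates every h-quasiconvex minorant of \<open>f\<close>.
  Letting \<open>n \<rightarrow> \<infinity>\<close> in \<open>T\<^sup>n\<^sup>+\<^sup>1[f](w) \<le> max {T\<^sup>n[f](p), T\<^sup>n[f](q)}\<close> shows that their limit is h-quasiconvex;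
  it is finite because \<open>f\<close> is bounded below, so it is itself the largest such minorant.\<close>

lemma mem_horizontal_plane_self: "p \<in> horizontal_plane p"
proof -
  have "p = p \<cdot>\<^sub>H (0, 0, 0)"
    by (cases p) simp
  then show ?thesis
    unfolding horizontal_plane_def horizontal_plane0_def by blast
qed

lemma h_conv_operator_le_max:
  assumes "p \<in> \<Omega>" "q \<in> horizontal_plane p \<inter> \<Omega>" "w \<in> closed_segment p q"
  shows "h_conv_operator \<Omega> u w \<le> max (u p) (u q)"
  unfolding h_conv_operator_def by (rule Inf_lower) (use assms in blast)

text \<open>The degenerate segment from \<open>w\<close> to \<open>w\<close> is admissible, as
  \<open>w\<close> lies in its own horizontal plane. Hence the iterates decrease on
  \<open>\<Omega>\<close>.\<close>

lemma h_conv_operator_le: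
  assumes "w \<in> \<Omega>"
  shows "h_conv_operator \<Omega> u w \<le> u w"
  using h_conv_operator_le_max[of w \<Omega> w w u] assms by (simp add: mem_horizontal_plane_self)

text \<open>By h-quasiconvexity, \<open>g w\<close> is a lower bound of the set whose infimum
  defines the operator. This is the induction step for the iterates.\<close>

lemma h_quasiconvex_le_h_conv_operator:
  assumes g: "h_quasiconvex_on \<Omega> g" and le: "\<And>x. x \<in> \<Omega> \<Longrightarrow> ereal (g x) \<le> u x"
  shows "ereal (g w) \<le> h_conv_operator \<Omega> u w"
  unfolding h_conv_operator_def
proof (rule Inf_greatest, clarify)
  fix p q
  assume w: "w \<in> closed_segment p q" and p: "p \<in> \<Omega>" and q: "q \<in> \<Omega>" "q \<in> horizontal_plane p"
  have "g w \<le> max (g p) (g q)"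
    using g w p q unfolding h_quasiconvex_on_def by blast
  then have "ereal (g w) \<le> max (ereal (g p)) (ereal (g q))"
    by (auto simp: max_def split: if_splits)
  also have "\<dots> \<le> max (u p) (u q)"
    using le p q by (intro max.mono) auto
  finally show "ereal (g w) \<le> max (u p) (u q)" .
qed

lemma h_quasiconvex_le_h_conv_operator_funpow:
  assumes g: "h_quasiconvex_on \<Omega> g" and le: "\<And>x. x \<in> \<Omega> \<Longrightarrow> ereal (g x) \<le> u x"
    and "w \<in> \<Omega>"
  shows "ereal (g w) \<le> (h_conv_operator \<Omega> ^^ n) u w"
  using \<open>w \<in> \<Omega>\<close>
proof (induction n arbitrary: w)
  case 0
  then show ?case by (simp add: le)
next
  case (Suc n)
  then show ?case by (simp add: h_quasiconvex_le_h_conv_operator[OF g])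
qed

lemma h_conv_operator_funpow_tendsto_INF:
  assumes "w \<in> \<Omega>"
  shows "(\<lambda>n. (h_conv_operator \<Omega> ^^ n) u w) \<longlonglongrightarrow> (INF n. (h_conv_operator \<Omega> ^^ n) u w)"
  by (rule LIMSEQ_INF) (simp add: decseq_Suc_iff h_conv_operator_le[OF assms])

text \<open>An infimum of maxima can exceed the maximum of the infima, so the inequality is obtained
  by passing to limits, which \<open>max\<close> respects.\<close>

lemma INF_h_conv_operator_funpow_le_max:
  fixes u :: "heis \<Rightarrow> ereal"
  assumes "h_convex \<Omega>" and p: "p \<in> \<Omega>" and q: "q \<in> horizontal_plane p \<inter> \<Omega>"
    and w: "w \<in> closed_segment p q"
  defines "F \<equiv> \<lambda>x. INF n. (h_conv_operator \<Omega> ^^ n) u x"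
  shows "F w \<le> max (F p) (F q)"
proof (rule LIMSEQ_le)
  have "w \<in> \<Omega>"
    using assms(1) p q w unfolding h_convex_def by blast
  then show "(\<lambda>n. (h_conv_operator \<Omega> ^^ Suc n) u w) \<longlonglongrightarrow> F w"
    unfolding F_def by (intro LIMSEQ_Suc h_conv_operator_funpow_tendsto_INF)
  show "(\<lambda>n. max ((h_conv_operator \<Omega> ^^ n) u p) ((h_conv_operator \<Omega> ^^ n) u q))
          \<longlonglongrightarrow> max (F p) (F q)"
    unfolding F_def using p q by (intro tendsto_max h_conv_operator_funpow_tendsto_INF) auto
  \<comment> \<open>The index shift matters: the bound is that of one application of the operator,
    taken at the \<open>n\<close>-th iterate.\<close>
  show "\<exists>N. \<forall>n\<ge>N. (h_conv_operator \<Omega> ^^ Suc n) u w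
          \<le> max ((h_conv_operator \<Omega> ^^ n) u p) ((h_conv_operator \<Omega> ^^ n) u q)"
    using h_conv_operator_le_max[OF p q w] by simp
qed

theorem theorem2p12:
  fixes \<Omega> :: "heis set" and f :: "heis \<Rightarrow> real"
  assumes "open \<Omega>" and "connected \<Omega>" and "h_convex \<Omega>"
    and "bdd_below (f ` \<Omega>)"
  shows "\<forall>w\<in>\<Omega>. (\<lambda>n. (h_conv_operator \<Omega> ^^ n) (\<lambda>x. ereal (f x)) w)
           \<longlonglongrightarrow> h_quasiconvex_envelope \<Omega> f w"
proof
  fix w assume w: "w \<in> \<Omega>"
  define F where "F = (\<lambda>x. INF n. (h_conv_operator \<Omega> ^^ n) (\<lambda>x. ereal (f x)) x)"
  obtain c where c: "\<And>x. x \<in> \<Omega> \<Longrightarrow> c \<le> f x"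
    using assms(4) unfolding bdd_below_def by auto
  have minorant_le: "ereal (g x) \<le> F x"
    if "h_quasiconvex_on \<Omega> g" "\<forall>x\<in>\<Omega>. g x \<le> f x" "x \<in> \<Omega>" for g x
    unfolding F_def using that
    by (intro INF_greatest h_quasiconvex_le_h_conv_operator_funpow) auto
  have F_ge: "ereal c \<le> F x" if "x \<in> \<Omega>" for x
    \<comment> \<open>The constant function \<open>c\<close> is an h-quasiconvex minorant of
      \<open>f\<close>.\<close>
    using minorant_le[of "\<lambda>_. c"] c that by (auto simp: h_quasiconvex_on_def)
  have F_le: "F x \<le> ereal (f x)" for x
    \<comment> \<open>The zeroth iterate is \<open>f\<close> itself.\<close>
    unfolding F_def by (rule INF_lower2[of 0]) auto
  \<comment> \<open>The envelope ranges over real-valued functions, so \<open>F\<close> needs a real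
    version. It is faithful on \<open>\<Omega>\<close>, where \<open>F\<close> is finite; infinite
    values would become 0.\<close>
  define G where "G = (\<lambda>x. real_of_ereal (F x))"
  have G: "ereal (G x) = F x" if "x \<in> \<Omega>" for x
    using F_ge[OF that] F_le[of x] unfolding G_def by (cases "F x") auto
  have "h_quasiconvex_on \<Omega> G"
    unfolding h_quasiconvex_on_def
  proof (intro ballI)
    fix p q v assume pqv: "p \<in> \<Omega>" "q \<in> horizontal_plane p \<inter> \<Omega>" "v \<in> closed_segment p q"
    then have "v \<in> \<Omega>"
      using assms(3) unfolding h_convex_def by blast
    then have "ereal (G v) \<le> max (ereal (G p)) (ereal (G q))"
      using INF_h_conv_operator_funpow_le_max[OF assms(3) pqv] pqv(1,2)
      by (simp add: G) (simp add: F_def)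
    then show "G v \<le> max (G p) (G q)"
      by (auto simp: max_def split: if_splits)
  qed
  moreover have "\<forall>x\<in>\<Omega>. G x \<le> f x"
    using F_le G by (metis ereal_less_eq(3))
  \<comment> \<open>The witness is \<open>G\<close>: the supremum is attained, so \<open>F w\<close>
    is a maximum.\<close>
  ultimately have "F w \<in> {ereal (g w) |g. h_quasiconvex_on \<Omega> g \<and> (\<forall>x\<in>\<Omega>. g x \<le> f x)}"
    using G[OF w, symmetric] by blast
  moreover have "y \<le> F w"
    if "y \<in> {ereal (g w) |g. h_quasiconvex_on \<Omega> g \<and> (\<forall>x\<in>\<Omega>. g x \<le> f x)}" for y
    using that minorant_le w by blast
  ultimately have "h_quasiconvex_envelope \<Omega> f w = F w"
    unfolding h_quasiconvex_envelope_def by (intro Sup_eqI)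
  then show "(\<lambda>n. (h_conv_operator \<Omega> ^^ n) (\<lambda>x. ereal (f x)) w)
      \<longlonglongrightarrow> h_quasiconvex_envelope \<Omega> f w"
    using h_conv_operator_funpow_tendsto_INF[OF w, of "\<lambda>x. ereal (f x)"] by (simp add: F_def)
qed

end
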